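(* Let $\mathcal Z_\theta\subset\mathbb R^d$ be a nonempty set. For every $b\in\mathbb R^d$ let $\mathcal P_{\mathcal Z_\theta+b}$ be a (possibly set-valued) projection rule on $\mathbb R^d$ onto the translate $\mathcal Z_\theta+b=\{z+b: z\in\mathcal Z_\theta\}$ (with $b=0$ giving $\mathcal P_{\mathcal Z_\theta}$). For $b\in\mathbb R^d$ and $w\in\mathcal Z_\theta+b$, define the displacement set $$V_{\mathcal Z_\theta+b}(w):=\{v\in\mathbb R^d:\ w\in\mathcal P_{\mathcal Z_\theta+b}(w+v)\}.$$ Then $$V_{\mathcal Z_\theta+b}(z+b)=V_{\mathcal Z_\theta}(z)\qquad\text{for all } b\in\mathbb R^d \text{ and all } z\in\mathcal Z_\theta$$ if and only if the projection rule is translation-equivariant, that is, $$\mathcal P_{\mathcal Z_\theta+b}(y+b)=\mathcal P_{\mathcal Z_\theta}(y)+b\qquad\text{for all } y,b\in\mathbb R^d .$$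
   Context: A (possibly set-valued) projection rule onto a set $C\subset\mathbb R^d$ is a map $\mathcal P_C$ assigning to each $y\in\mathbb R^d$ a subset $\mathcal P_C(y)\subseteq C$ (a singleton if the rule is single-valued). No further property, such as being a nearest-point map, is assumed. For a set $A\subset\mathbb R^d$ and $b\in\mathbb R^d$, $A+b=\{a+b:a\in A\}$. *)

theory Defs
  imports "HOL-Analysis.Analysis"
begin

definition projection_rule :: "(real ^ 'd) set \<Rightarrow> (real ^ 'd \<Rightarrow> (real ^ 'd) set) \<Rightarrow> bool"
  where "projection_rule C P \<longleftrightarrow> (\<forall>y. P y \<subseteq> C)"

(* The set C enters only through the rule P onto it; the paper's V_C(w) is used for w in C. *)
definition displacement_set :: "(real ^ 'd \<Rightarrow> (real ^ 'd) set) \<Rightarrow> real ^ 'd \<Rightarrow> (real ^ 'd) set"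
  where "displacement_set P w = {v. w \<in> P (w + v)}"

definition translate :: "(real ^ 'd) set \<Rightarrow> real ^ 'd \<Rightarrow> (real ^ 'd) set"
  where "translate A b = {a + b | a. a \<in> A}"

end

theory Submission
  imports Defs
begin

text \<open>Both conditions unfold to one family of equivalences,
  \<open>z + b \<in> P b (y + b) \<longleftrightarrow> z \<in> P 0 y\<close> over all
  \<open>b\<close>, \<open>y\<close> and all \<open>z \<in> Z\<close>. Grouped by \<open>z\<close>,
  with \<open>y = z + v\<close>, it compares displacement sets
  (\<open>displacement_set_shift_eq_iff\<close>); grouped by \<open>y\<close>, it compares
  projections (\<open>projection_translate_eq_iff\<close>). No geometry of the rule enters beyond
  its values lying in the target set.\<close>

lemma mem_translate_iff: "w \<in> translate A b \<longleftrightarrow> w - b \<in> A"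
  by (force simp: translate_def)

lemma displacement_set_shift_eq_iff:
  "displacement_set Q (z + b) = displacement_set P z \<longleftrightarrow> (\<forall>y. z + b \<in> Q (y + b) \<longleftrightarrow> z \<in> P y)"
proof -
  have "displacement_set Q (z + b) = displacement_set P z \<longleftrightarrow>
      (\<forall>v. z + b \<in> Q ((z + v) + b) \<longleftrightarrow> z \<in> P (z + v))"
    by (simp add: displacement_set_def set_eq_iff add_ac)
  \<comment> \<open>For fixed \<open>z\<close>, the map from \<open>v\<close> to
    \<open>z + v\<close> is a bijection of the space; a given \<open>y\<close> is reached by
    \<open>v = y - z\<close>.\<close>
  also have "\<dots> \<longleftrightarrow> (\<forall>y. z + b \<in> Q (y + b) \<longleftrightarrow> z \<in> P y)"
    by (metis add_diff_cancel_left' diff_add_cancel add.commute)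
  finally show ?thesis .
qed

text \<open>Both sets being compared lie in the translate of \<open>Z\<close> by \<open>b\<close>,
  so testing membership at the points \<open>z + b\<close> with \<open>z \<in> Z\<close> decides
  equality.\<close>

lemma projection_translate_eq_iff:
  assumes "projection_rule (translate Z b) Q" and "projection_rule Z P"
  shows "Q (y + b) = translate (P y) b \<longleftrightarrow> (\<forall>z\<in>Z. z + b \<in> Q (y + b) \<longleftrightarrow> z \<in> P y)"
proof -
  have "w - b \<in> Z" if "w \<in> Q (y + b)" for w
    using assms(1) that unfolding projection_rule_def mem_translate_iff[symmetric] by blast
  moreover have "z \<in> Z" if "z \<in> P y" for z
    using assms(2) that by (auto simp: projection_rule_def)
  ultimately show ?thesis
    unfolding set_eq_iff mem_translate_iff by (metis add_diff_cancel_right' diff_add_cancel)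
qed

theorem theorem1:
  fixes Z :: "(real ^ 'd) set"
    and P :: "real ^ 'd \<Rightarrow> real ^ 'd \<Rightarrow> (real ^ 'd) set"
  assumes "Z \<noteq> {}"
    and "\<And>b. projection_rule (translate Z b) (P b)"
  shows "(\<forall>b. \<forall>z\<in>Z. displacement_set (P b) (z + b) = displacement_set (P 0) z)
     \<longleftrightarrow> (\<forall>y b. P b (y + b) = translate (P 0 y) b)"
proof -
  have "projection_rule Z (P 0)"
    using assms(2)[of 0] by (simp add: translate_def)
  then show ?thesis
    \<comment> \<open>What remains is to exchange the quantifiers over \<open>z\<close> and
      \<open>y\<close>.\<close>
    unfolding displacement_set_shift_eq_iff
    by (auto simp: projection_translate_eq_iff[OF assms(2)])
qed

end
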